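(* Let $n\ge 2$ be an integer and let $\alpha\in\mathbb{R}_{>0}$ with $\overline{\alpha}\in EVP^+$. Then $\lim_{i\to\infty}B(n^i\alpha)=\infty$. In particular, there exist $a,k\in\mathbb{N}$ such that $n^ia\le B(n^{i+k}\alpha)$ for every $i\in\mathbb{N}$. Moreover, every element of $EVP^+$ satisfies the $p$-adic Littlewood Conjecture, i.e. if $\overline{\alpha}\in EVP^+$ then for every prime $p$ $$\liminf_{q\to\infty}\ q\cdot|q|_p\cdot\|q\alpha\|=0 .$$
   Context: $\overline{\alpha}=[a_0;a_1,a_2,\dots]$ denotes the continued fraction expansion of $\alpha$ ($a_0\in\mathbb{Z}$, $a_i\in\mathbb{N}$ for $i\ge1$), and $B(\alpha):=\sup\{a_i: i\in\mathbb{N}\}$, the supremum of the partial quotients excluding $a_0$. A continued fraction is eventually periodic if it has the form $[b_0;\dots,b_r,\overline{a_1,\dots,a_s}]$ with $r\in\mathbb{N}\cup\{0\}$, where the bar denotes infinite repetition; $EVP^+$ is the set of eventually periodic continued fractions representing positive numbers. $|q|_p=p^{-\nu_p(q)}$ is the $p$-adic norm ($\nu_p(q)$ the largest $j\ge0$ with $p^j\mid q$), $\|x\|=\min\{|x-m|:m\in\mathbb{Z}\}$, and in the liminf $q$ ranges over the natural numbers. *)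

theory Defs
  imports "HOL-Library.Extended_Real" "HOL-Computational_Algebra.Primes"
begin

text \<open>Complete quotients and partial quotients of the continued fraction algorithm.
  The expansion \<open>[a\<^sub>0; a\<^sub>1, a\<^sub>2, \<dots>]\<close> of \<open>\<alpha>\<close> is the sequence \<open>cf_expansion \<alpha>\<close>.
  If \<open>\<alpha>\<close> is rational, the algorithm reaches an integer complete quotient; from then on
  \<open>inverse 0 = 0\<close> makes all further complete and partial quotients \<open>0\<close>, that is, a finite
  expansion is padded with zeros. Genuine partial quotients of index at least \<open>1\<close> are positive,
  so the padding cannot be confused with them.\<close>

primrec complete_quotient :: "real \<Rightarrow> nat \<Rightarrow> real" where
  "complete_quotient \<alpha> 0 = \<alpha>"
| "complete_quotient \<alpha> (Suc i) = inverse (frac (complete_quotient \<alpha> i))"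

definition cf_expansion :: "real \<Rightarrow> nat \<Rightarrow> int" where
  "cf_expansion \<alpha> i = \<lfloor>complete_quotient \<alpha> i\<rfloor>"

text \<open>The value of \<open>[a\<^sub>0; a\<^sub>1, \<dots>, a\<^sub>n\<^sub>-\<^sub>1, x]\<close>; it is used only in \<open>cf_expansion_correct\<close>.\<close>

primrec cf_eval :: "(nat \<Rightarrow> int) \<Rightarrow> nat \<Rightarrow> real \<Rightarrow> real" where
  "cf_eval a 0 x = x"
| "cf_eval a (Suc n) x = cf_eval a n (of_int (a n) + 1 / x)"

lemma complete_quotient_irrational:
  assumes "\<alpha> \<notin> \<rat>"
  shows "complete_quotient \<alpha> i \<notin> \<rat>"
proof (induction i)
  case (Suc i)
  then show ?case
    by (auto simp: frac_def dest: Rats_inverse) (metis Rats_add Rats_inverse Rats_of_int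
        diff_add_cancel inverse_inverse_eq)
qed (use assms in simp)

lemma cf_expansion_pos:
  assumes "\<alpha> \<notin> \<rat>" "1 \<le> i"
  shows "1 \<le> cf_expansion \<alpha> i"
proof -
  obtain j where j: "i = Suc j" using assms(2) by (cases i) auto
  have "frac (complete_quotient \<alpha> j) > 0"
    using complete_quotient_irrational[OF assms(1), of j] Ints_subset_Rats
    by (auto simp: frac_gt_0_iff)
  moreover have "frac (complete_quotient \<alpha> j) < 1" by (rule frac_lt_1)
  ultimately have "1 \<le> inverse (frac (complete_quotient \<alpha> j))"
    by (simp add: one_le_inverse)
  then show ?thesis by (simp add: cf_expansion_def j le_floor_iff)
qed

lemma cf_expansion_correct: "cf_eval (cf_expansion \<alpha>) n (complete_quotient \<alpha> n) = \<alpha>"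
proof (induction n)
  case (Suc n)
  have "of_int (cf_expansion \<alpha> n) + 1 / complete_quotient \<alpha> (Suc n) = complete_quotient \<alpha> n"
    by (simp add: cf_expansion_def frac_def field_simps)
  with Suc show ?case by simp
qed simp

text \<open>The supremum is taken in \<open>\<nat> \<union> {\<infinity>}\<close>; zeros padding a finite expansion do not affect it.\<close>

definition B :: "real \<Rightarrow> enat" where
  "B \<alpha> = (SUP i\<in>{1..}. enat (nat (cf_expansion \<alpha> i)))"

text \<open>The sequence \<open>b\<^sub>0, \<dots>, b\<^sub>r, a\<^sub>1, \<dots>, a\<^sub>s, a\<^sub>1, \<dots>, a\<^sub>s, \<dots>\<close> for
  \<open>bs = [b\<^sub>0, \<dots>, b\<^sub>r]\<close> and \<open>ps = [a\<^sub>1, \<dots>, a\<^sub>s]\<close>.\<close>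

definition eventually_periodic_seq :: "int list \<Rightarrow> int list \<Rightarrow> nat \<Rightarrow> int" where
  "eventually_periodic_seq bs ps i =
     (if i < length bs then bs ! i else ps ! ((i - length bs) mod length ps))"

definition EVP :: "(nat \<Rightarrow> int) set" where
  "EVP = {eventually_periodic_seq bs ps | bs ps.
     bs \<noteq> [] \<and> ps \<noteq> [] \<and> (\<forall>b\<in>set (tl bs). 1 \<le> b) \<and> (\<forall>a\<in>set ps. 1 \<le> a)}"

definition EVP_pos :: "(nat \<Rightarrow> int) set" where
  "EVP_pos = {c \<in> EVP. \<exists>\<alpha>>0. cf_expansion \<alpha> = c}"

definition padic_norm :: "nat \<Rightarrow> nat \<Rightarrow> real" where
  "padic_norm p q = (if q = 0 then 0 else 1 / real p ^ multiplicity p q)"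

text \<open>The infimum is attained, so it is the minimum.\<close>

definition dist_nearest_int :: "real \<Rightarrow> real" where
  "dist_nearest_int x = (INF m::int. \<bar>x - of_int m\<bar>)"

definition padic_littlewood :: "nat \<Rightarrow> real \<Rightarrow> bool" where
  "padic_littlewood p \<alpha> \<longleftrightarrow>
     liminf (\<lambda>q. ereal (real q * padic_norm p q * dist_nearest_int (real q * \<alpha>))) = 0"

end

theory Submission
  imports Defs
begin

text \<open>Periodicity makes \<open>(\<alpha>, 1)\<close> an eigenvector of an integer matrix \<open>Q\<close> of determinant
  \<open>\<plusminus>1\<close> with eigenvalue \<open>\<lambda> > 1\<close>. By Cayley--Hamilton \<open>Q\<^sup>j = u\<^sub>j Q - d u\<^sub>j\<^sub>-\<^sub>1\<close>, where \<open>u\<close> is the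
  Lucas sequence of the characteristic polynomial and \<open>d = det Q\<close>. By pigeonhole \<open>N\<close> divides
  some \<open>u\<^sub>j\<close>, hence the lower left entry \<open>C\<close> of \<open>Q\<^sup>j\<close>, and \<open>\<bar>C\<bar> = O(\<lambda>\<^sup>j)\<close> uniformly in \<open>N\<close>.
  For \<open>N = n\<^sup>m\<close>, conjugation by \<open>diag(n\<^sup>m, 1)\<close> turns \<open>Q\<^sup>j\<close> into an integer matrix fixing
  \<open>n\<^sup>m \<alpha>\<close> with lower left entry \<open>C / n\<^sup>m\<close>; this forces a partial quotient of
  order \<open>\<lambda>\<^sup>j n\<^sup>m / \<bar>C\<bar>\<close>, which is at least a constant times \<open>n\<^sup>m\<close>. For \<open>N = p\<^sup>m\<close>, the number \<open>q = \<bar>C\<bar>\<close>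
  satisfies \<open>\<parallel>q \<alpha>\<parallel> \<le> \<lambda>\<^sup>-\<^sup>j\<close> and \<open>\<bar>q\<bar>\<^sub>p \<le> p\<^sup>-\<^sup>m\<close>.\<close>

section \<open>Complete quotients, and uniqueness of infinite expansions\<close>

lemma complete_quotient_shift:
  "complete_quotient x (i + j) = complete_quotient (complete_quotient x i) j"
  by (induction j) auto

lemma complete_quotient_1:
  assumes "(x - of_int a) * z = 1" "z > 1"
  shows "complete_quotient x 1 = z"
proof -
  have e: "x - of_int a = 1 / z" using assms by (simp add: field_simps)
  then have "0 < x - of_int a" "x - of_int a < 1" using assms by auto
  then have "\<lfloor>x\<rfloor> = a" by (simp add: floor_eq_iff)
  then have "frac x = 1 / z" using e by (simp add: frac_def)
  then show ?thesis by simp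
qed

lemma complete_quotient_gt_1:
  assumes "\<And>i. 1 \<le> i \<Longrightarrow> 1 \<le> cf_expansion x i" "1 \<le> i"
  shows "1 < complete_quotient x i"
proof -
  \<comment> \<open>The index \<open>Suc i\<close> excludes the value 1: after an integer complete
    quotient the next partial quotient is 0, because \<open>inverse 0 = 0\<close>.\<close>
  have "1 \<le> cf_expansion x i" "1 \<le> cf_expansion x (Suc i)" using assms by auto
  then have a: "1 \<le> complete_quotient x i" and b: "frac (complete_quotient x i) \<noteq> 0"
    by (auto simp: cf_expansion_def le_floor_iff simp del: frac_eq_0_iff)
  from b have "complete_quotient x i \<noteq> 1" by (metis Ints_1 frac_eq_0_iff)
  with a show ?thesis by linarith
qed

lemma complete_quotient_step:
  "complete_quotient x i = of_int (cf_expansion x i) + 1 / complete_quotient x (Suc i)"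
  by (simp add: cf_expansion_def frac_def field_simps)

text \<open>When the partial quotients agree, passing from index \<open>i\<close> to
  \<open>i + 1\<close> multiplies the distance of the complete quotients by the product of the two
  new ones. A single quotient may be close to 1, but two consecutive ones have product at least 2,
  so two steps gain a factor 4. All distances being at most 1, the initial one is 0.\<close>

lemma cf_expansion_inject:
  assumes x: "\<And>i. 1 \<le> i \<Longrightarrow> 1 \<le> cf_expansion x i"
    and eq: "cf_expansion x = cf_expansion y"
  shows "x = y"
proof -
  let ?X = "complete_quotient x" and ?Y = "complete_quotient y"
  have y: "\<And>i. 1 \<le> i \<Longrightarrow> 1 \<le> cf_expansion y i" using x eq by simp
  have prod: "2 \<le> complete_quotient z (Suc i) * complete_quotient z (Suc (Suc i))"
    if z: "\<And>i. 1 \<le> i \<Longrightarrow> 1 \<le> cf_expansion z i" for z i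
  proof -
    have g: "1 < complete_quotient z (Suc (Suc i))" by (intro complete_quotient_gt_1 z) auto
    have "(1::real) \<le> of_int (cf_expansion z (Suc i))" using z[of "Suc i"] by simp
    then have "1 * 1 \<le> of_int (cf_expansion z (Suc i)) * complete_quotient z (Suc (Suc i))"
      using g by (intro mult_mono) auto
    then show ?thesis
      using complete_quotient_step[of z "Suc i"] g by (simp add: field_simps del: complete_quotient.simps)
  qed
  have step: "\<bar>?X i - ?Y i\<bar> * (?X (Suc i) * ?Y (Suc i)) = \<bar>?X (Suc i) - ?Y (Suc i)\<bar>" for i
  proof -
    have g: "1 < ?X (Suc i)" "1 < ?Y (Suc i)"
      by (intro complete_quotient_gt_1 x y; simp)+
    have "?X i - ?Y i = 1 / ?X (Suc i) - 1 / ?Y (Suc i)"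
      using complete_quotient_step[of x i] complete_quotient_step[of y i] eq by simp
    then have "(?X i - ?Y i) * (?X (Suc i) * ?Y (Suc i)) = ?Y (Suc i) - ?X (Suc i)"
      using g by (simp add: field_simps del: complete_quotient.simps)
    then have "\<bar>(?X i - ?Y i) * (?X (Suc i) * ?Y (Suc i))\<bar> = \<bar>?X (Suc i) - ?Y (Suc i)\<bar>"
      by linarith
    then show ?thesis using g by (simp add: abs_mult del: complete_quotient.simps)
  qed
  have two: "\<bar>?X i - ?Y i\<bar> * 4 \<le> \<bar>?X (i + 2) - ?Y (i + 2)\<bar>" for i
  proof -
    have "2 * 2 \<le> (?X (Suc i) * ?X (Suc (Suc i))) * (?Y (Suc i) * ?Y (Suc (Suc i)))"
      using prod[of x i, OF x] prod[of y i, OF y] by (intro mult_mono) auto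
    then have "\<bar>?X i - ?Y i\<bar> * 4 \<le>
        \<bar>?X i - ?Y i\<bar> * ((?X (Suc i) * ?X (Suc (Suc i))) * (?Y (Suc i) * ?Y (Suc (Suc i))))"
      by (intro mult_left_mono) auto
    also have "\<dots> = \<bar>?X i - ?Y i\<bar> * (?X (Suc i) * ?Y (Suc i)) * (?X (Suc (Suc i)) * ?Y (Suc (Suc i)))"
      by (simp only: ac_simps)
    also have "\<dots> = \<bar>?X (i + 2) - ?Y (i + 2)\<bar>"
      by (simp only: step) simp
    finally show ?thesis .
  qed
  have small: "\<bar>?X i - ?Y i\<bar> * 4 ^ k \<le> 1" for i k
  proof (induction k arbitrary: i)
    case 0
    have "\<lfloor>?X i\<rfloor> = \<lfloor>?Y i\<rfloor>" using eq by (metis cf_expansion_def)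
    then show ?case by simp linarith
  next
    case (Suc k)
    have "\<bar>?X i - ?Y i\<bar> * 4 ^ Suc k = (\<bar>?X i - ?Y i\<bar> * 4) * 4 ^ k" by simp
    also have "\<dots> \<le> \<bar>?X (i + 2) - ?Y (i + 2)\<bar> * 4 ^ k"
      using two[of i] by (intro mult_right_mono) auto
    also have "\<dots> \<le> 1" by (rule Suc)
    finally show ?case .
  qed
  show ?thesis
  proof (rule ccontr)
    assume "x \<noteq> y"
    then have p: "\<bar>x - y\<bar> > 0" by simp
    obtain k where "1 / \<bar>x - y\<bar> < 4 ^ k" using real_arch_pow[of 4] by auto
    then show False using small[of 0 k] p by (simp add: field_simps)
  qed
qed

section \<open>Unimodular integer matrices with eigenvector \<open>(x, 1)\<close>\<close>

text \<open>The matrix has rows \<open>(A, E)\<close> and \<open>(C, D)\<close>; its Moebius map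
  fixes \<open>x\<close>, with denominator \<open>l\<close>.\<close>

definition unit_eigen :: "real \<Rightarrow> int \<Rightarrow> int \<Rightarrow> int \<Rightarrow> int \<Rightarrow> real \<Rightarrow> bool" where
  "unit_eigen x A E C D l \<longleftrightarrow> \<bar>A * D - E * C\<bar> = 1 \<and>
     of_int A * x + of_int E = l * x \<and> of_int C * x + of_int D = l"

text \<open>Conjugation by the matrix \<open>P\<close> with rows \<open>(a, 1)\<close> and
  \<open>(1, 0)\<close>, which sends \<open>(y, 1)\<close> to \<open>y\<close> times
  \<open>(x, 1)\<close>; determinant and eigenvalue are unchanged.\<close>

lemma unit_eigen_mobius:
  assumes "unit_eigen y A E C D l" "(x - of_int a) * y = 1"
  shows "unit_eigen x (a * E + D) (a * A + C - a * (a * E + D)) E (A - a * E) l"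
proof -
  have y: "y \<noteq> 0" using assms(2) by auto
  have e: "of_int A * y + of_int E = l * y" "of_int C * y + of_int D = l"
    and d: "\<bar>A * D - E * C\<bar> = 1" using assms(1) by (auto simp: unit_eigen_def)
  have xy: "x * y = of_int a * y + 1" using assms(2) by (simp add: algebra_simps)
  have r2: "of_int E * x + of_int (A - a * E) = l"
  proof -
    have "(of_int E * x + of_int (A - a * E)) * y = of_int E * (x * y) + of_int (A - a * E) * y"
      by (simp add: algebra_simps)
    also have "\<dots> = l * y" unfolding xy e(1)[symmetric] by (simp add: algebra_simps)
    finally show ?thesis using y by simp
  qed
  have r1: "of_int (a * E + D) * x + of_int (a * A + C - a * (a * E + D)) = l * x"
  proof -
    have "(of_int (a * E + D) * x + of_int (a * A + C - a * (a * E + D))) * y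
        = of_int (a * E + D) * (x * y) + of_int (a * A + C - a * (a * E + D)) * y"
      by (simp add: algebra_simps)
    also have "\<dots> = of_int a * (of_int A * y + of_int E) + (of_int C * y + of_int D)"
      unfolding xy by (simp add: algebra_simps)
    also have "\<dots> = l * (x * y)" unfolding e xy by (simp add: algebra_simps)
    finally show ?thesis using y by simp
  qed
  have "(a * E + D) * (A - a * E) - (a * A + C - a * (a * E + D)) * E = A * D - E * C"
    by (simp add: algebra_simps)
  with d r1 r2 show ?thesis by (simp only: unit_eigen_def)
qed

text \<open>\<open>A / C\<close> and \<open>E / D\<close> are the consecutive convergents of index
  \<open>s\<close> and \<open>s - 1\<close>; the induction is their usual recursion.\<close>

lemma cf_numerators_denominators:
  assumes pos: "\<And>i. 1 \<le> i \<Longrightarrow> 1 \<le> cf_expansion x i"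
  shows "\<exists>A E C D. \<bar>A * D - E * C\<bar> = 1 \<and> 1 \<le> C \<and> 0 \<le> D \<and>
    x * (of_int C * complete_quotient x (Suc s) + of_int D) =
      of_int A * complete_quotient x (Suc s) + of_int E"
proof (induction s)
  case 0
  have "1 < complete_quotient x (Suc 0)" by (intro complete_quotient_gt_1 pos) auto
  then show ?case using complete_quotient_step[of x 0]
    by (intro exI[of _ "cf_expansion x 0"] exI[of _ 1] exI[of _ 0])
       (auto simp: field_simps simp del: complete_quotient.simps(2))
next
  case (Suc s)
  let ?y = "complete_quotient x (Suc s)" and ?z = "complete_quotient x (Suc (Suc s))"
  let ?a = "cf_expansion x (Suc s)"
  obtain A E C D where d: "\<bar>A * D - E * C\<bar> = 1" "1 \<le> C" "0 \<le> D"
    and e: "x * (of_int C * ?y + of_int D) = of_int A * ?y + of_int E" using Suc by blast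
  have z: "1 < ?z" by (intro complete_quotient_gt_1 pos) auto
  have yz: "?y * ?z = of_int ?a * ?z + 1"
    using complete_quotient_step[of x "Suc s"] z by (simp add: field_simps del: complete_quotient.simps)
  have "x * (of_int C * (?y * ?z) + of_int D * ?z) = (x * (of_int C * ?y + of_int D)) * ?z"
    by (simp add: algebra_simps del: complete_quotient.simps)
  also have "\<dots> = of_int A * (?y * ?z) + of_int E * ?z"
    unfolding e by (simp add: algebra_simps del: complete_quotient.simps)
  finally have "x * (of_int (?a * C + D) * ?z + of_int C) = of_int (?a * A + E) * ?z + of_int A"
    unfolding yz by (simp add: algebra_simps del: complete_quotient.simps)
  moreover have "\<bar>(?a * A + E) * C - A * (?a * C + D)\<bar> = 1"
  proof -
    have "(?a * A + E) * C - A * (?a * C + D) = - (A * D - E * C)" by (simp add: algebra_simps)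
    then show ?thesis using d by simp
  qed
  moreover have "1 \<le> ?a * C + D"
  proof -
    have "1 * 1 \<le> ?a * C" using pos[of "Suc s"] d by (intro mult_mono) auto
    then show ?thesis using d by simp
  qed
  ultimately show ?case using d
    by (intro exI[of _ "?a * A + E"] exI[of _ A] exI[of _ "?a * C + D"] exI[of _ C]) simp
qed

text \<open>The purely periodic tail \<open>y\<close> is fixed by the convergent matrix of one
  period, with eigenvalue \<open>C * y + D > 1\<close>. Conjugating through the preperiod carries
  this matrix back to \<open>x\<close>.\<close>

lemma EVP_unit_eigen:
  assumes "cf_expansion x \<in> EVP"
  obtains A E C D l where "unit_eigen x A E C D l" "1 < l"
proof -
  obtain bs ps where c: "cf_expansion x = eventually_periodic_seq bs ps"
    and ne: "bs \<noteq> []" "ps \<noteq> []"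
    and bs: "\<forall>b\<in>set (tl bs). 1 \<le> b" and ps: "\<forall>a\<in>set ps. 1 \<le> a"
    using assms by (auto simp: EVP_def)
  have pos: "1 \<le> cf_expansion x i" if "1 \<le> i" for i
  proof (cases "i < length bs")
    case True
    then have "bs ! i = tl bs ! (i - 1)" "i - 1 < length (tl bs)"
      using that by (auto simp: nth_tl)
    then show ?thesis using bs True by (auto simp: c eventually_periodic_seq_def)
  next
    case False
    then show ?thesis using ps ne by (simp add: c eventually_periodic_seq_def)
  qed
  define r s where "r = length bs" and "s = length ps"
  have rs: "1 \<le> r" "1 \<le> s" using ne by (auto simp: r_def s_def Suc_le_eq)
  let ?y = "complete_quotient x r"
  have shift: "cf_expansion (complete_quotient x j) i = cf_expansion x (j + i)" for i j
    by (simp add: cf_expansion_def complete_quotient_shift)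
  have ypos: "1 \<le> cf_expansion ?y i" for i using pos rs by (simp add: shift)
  \<comment> \<open>Periodicity of the digits becomes an equation between reals.\<close>
  have "?y = complete_quotient x (r + s)"
  proof (rule cf_expansion_inject)
    show "cf_expansion ?y = cf_expansion (complete_quotient x (r + s))"
      by (auto simp: shift c eventually_periodic_seq_def r_def s_def fun_eq_iff)
  qed (use ypos in auto)
  then have y: "complete_quotient ?y (Suc (s - 1)) = ?y"
    using rs by (simp add: complete_quotient_shift)
  obtain A E C D where d: "\<bar>A * D - E * C\<bar> = 1" "1 \<le> C" "0 \<le> D"
    and e: "?y * (of_int C * ?y + of_int D) = of_int A * ?y + of_int E"
    using cf_numerators_denominators[of ?y "s - 1", OF ypos] unfolding y by blast
  let ?l = "of_int C * ?y + of_int D"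
  have "1 < ?y" using rs by (intro complete_quotient_gt_1 pos)
  then have "1 * ?y \<le> of_int C * ?y" using d by (intro mult_right_mono) auto
  moreover have "0 \<le> real_of_int D" using d by simp
  ultimately have l: "1 < ?l" using \<open>1 < ?y\<close> by linarith
  have "\<exists>A E C D. unit_eigen (complete_quotient x (r - k)) A E C D ?l" if "k \<le> r" for k
    using that
  proof (induction k)
    case 0
    have "unit_eigen ?y A E C D ?l" using d e by (simp add: unit_eigen_def mult.commute)
    then show ?case by auto
  next
    case (Suc k)
    define j where "j = r - Suc k"
    have j: "r - k = Suc j" using Suc by (simp add: j_def)
    then obtain A E C D where "unit_eigen (complete_quotient x (Suc j)) A E C D ?l"
      using Suc by auto
    moreover have "1 < complete_quotient x (Suc j)" by (intro complete_quotient_gt_1 pos) auto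
    then have "(complete_quotient x j - of_int (cf_expansion x j)) * complete_quotient x (Suc j) = 1"
      using complete_quotient_step[of x j] by (simp add: field_simps del: complete_quotient.simps)
    ultimately show ?case unfolding j_def[symmetric] using unit_eigen_mobius by blast
  qed
  from this[of r] show thesis using l that by auto
qed

section \<open>Lucas sequences and powers of the matrix\<close>

fun lucas :: "int \<Rightarrow> int \<Rightarrow> nat \<Rightarrow> int" where
  "lucas t d 0 = 0"
| "lucas t d (Suc 0) = 1"
| "lucas t d (Suc (Suc j)) = t * lucas t d (Suc j) - d * lucas t d j"

text \<open>Times \<open>d\<close>, the left side is the norm of \<open>u * l - d * v\<close>, where
  \<open>u\<close>, \<open>v\<close> are the terms at \<open>Suc j\<close>, \<open>j\<close> and
  \<open>l\<close> is a root of the characteristic polynomial. It will give the determinant of the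
  matrix power.\<close>

lemma lucas_norm:
  "lucas t d (Suc j) ^ 2 - t * lucas t d (Suc j) * lucas t d j + d * lucas t d j ^ 2 = d ^ j"
proof (induction j)
  case (Suc j)
  have "lucas t d (Suc (Suc j)) ^ 2 - t * lucas t d (Suc (Suc j)) * lucas t d (Suc j)
      + d * lucas t d (Suc j) ^ 2
    = d * (lucas t d (Suc j) ^ 2 - t * lucas t d (Suc j) * lucas t d j + d * lucas t d j ^ 2)"
    by (simp add: power2_eq_square algebra_simps)
  then show ?case using Suc by simp
qed simp

text \<open>Cayley-Hamilton evaluated on an eigenvalue.\<close>

lemma lucas_root_power:
  fixes l :: real
  assumes "l ^ 2 = of_int t * l - of_int d"
  shows "of_int (lucas t d (Suc j)) * l - of_int d * of_int (lucas t d j) = l ^ Suc j"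
proof (induction j)
  case (Suc j)
  let ?u = "of_int (lucas t d (Suc j)) :: real" and ?v = "of_int (lucas t d j) :: real"
  have "of_int (lucas t d (Suc (Suc j))) * l - of_int d * ?u
      = ?u * (of_int t * l - of_int d) - of_int d * ?v * l"
    by (simp add: algebra_simps)
  also have "\<dots> = l * (?u * l - of_int d * ?v)"
    unfolding assms[symmetric] by (simp add: power2_eq_square algebra_simps)
  also have "\<dots> = l ^ Suc (Suc j)" unfolding Suc by simp
  finally show ?case .
qed simp

text \<open>Binet's formula with cleared denominator; it controls the size of the Lucas
  terms.\<close>

lemma lucas_binet:
  fixes l m :: real
  assumes "l + m = of_int t" "l * m = of_int d"
  shows "(l - m) * of_int (lucas t d j) = l ^ j - m ^ j"
proof -
  have "(l - m) * of_int (lucas t d j) = l ^ j - m ^ j \<and>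
    (l - m) * of_int (lucas t d (Suc j)) = l ^ Suc j - m ^ Suc j"
  proof (induction j)
    case (Suc j)
    have "(l - m) * of_int (lucas t d (Suc (Suc j))) =
        (l + m) * ((l - m) * of_int (lucas t d (Suc j))) - l * m * ((l - m) * of_int (lucas t d j))"
      unfolding assms by (simp add: algebra_simps)
    also have "\<dots> = (l + m) * (l ^ Suc j - m ^ Suc j) - l * m * (l ^ j - m ^ j)"
      using Suc by (simp only:)
    also have "\<dots> = l ^ Suc (Suc j) - m ^ Suc (Suc j)" by (simp add: algebra_simps)
    finally show ?case using Suc by simp
  qed simp
  then show ?thesis by simp
qed

text \<open>As \<open>d\<close> is a unit, the recurrence also runs backwards modulo
  \<open>N\<close>: the congruent pairs descend to index 0, where the term is 0.\<close>

lemma lucas_dvd_of_cong: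
  fixes N :: int
  assumes "\<bar>d\<bar> = 1" "N dvd lucas t d (i + k) - lucas t d i"
    "N dvd lucas t d (Suc (i + k)) - lucas t d (Suc i)"
  shows "N dvd lucas t d k"
  using assms(2,3)
proof (induction i)
  case (Suc i)
  have "d * (lucas t d (i + k) - lucas t d i) = t * (lucas t d (Suc i + k) - lucas t d (Suc i))
    - (lucas t d (Suc (Suc i + k)) - lucas t d (Suc (Suc i)))"
    by (simp add: algebra_simps)
  also have "N dvd \<dots>"
    by (rule dvd_diff[OF dvd_mult]) (use Suc.prems in \<open>simp_all only: add_Suc\<close>)
  finally have "N dvd \<bar>d * (lucas t d (i + k) - lucas t d i)\<bar>" by simp
  then have "N dvd lucas t d (i + k) - lucas t d i" by (simp add: abs_mult assms(1))
  then show ?case using Suc by simp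
qed simp

lemma lucas_divisible:
  fixes N :: int
  assumes "\<bar>d\<bar> = 1" "N > 0"
  obtains j where "N dvd lucas t d (Suc j)"
proof -
  \<comment> \<open>Pigeonhole on residues of consecutive pairs, since a pair determines the whole
    sequence modulo \<open>N\<close>.\<close>
  define f where "f j = (lucas t d j mod N, lucas t d (Suc j) mod N)" for j
  have "range f \<subseteq> {0..<N} \<times> {0..<N}" using assms(2) by (auto simp: f_def)
  then have "finite (range f)" by (rule finite_subset) simp
  then have "\<not> inj f" using finite_imageD by blast
  then obtain i j where ij: "f i = f j" "i < j"
    unfolding inj_def by (metis nat_neq_iff)
  obtain k where k: "j = i + Suc k" using ij(2) less_iff_Suc_add by auto
  have "N dvd lucas t d (Suc k)"
    using ij(1) k lucas_dvd_of_cong[OF assms(1), of N t i "Suc k"]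
    by (auto simp: f_def mod_eq_dvd_iff dvd_diff_commute)
  then show thesis by (rule that)
qed

lemma unit_eigen_divisible:
  assumes "unit_eigen x A E C D l" "1 < l"
  obtains \<kappa> where "\<kappa> > 0" "\<And>N. N > 0 \<Longrightarrow> \<exists>A E C D l. unit_eigen x A E C D l \<and>
    C \<noteq> 0 \<and> N dvd C \<and> \<kappa> * \<bar>of_int C\<bar> \<le> l"
proof -
  define t d where "t = A + D" and "d = A * D - E * C"
  have d: "\<bar>d\<bar> = 1" and e1: "of_int A * x + of_int E = l * x" and e2: "of_int C * x + of_int D = l"
    using assms(1) by (auto simp: unit_eigen_def d_def)
  \<comment> \<open>For \<open>C = 0\<close> the eigenvalue would be \<open>D\<close>, which is then
    1 or -1.\<close>
  have "C \<noteq> 0"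
  proof
    assume C: "C = 0"
    then have "\<bar>D * A\<bar> = 1" using d by (simp add: d_def mult.commute)
    then have "\<bar>D\<bar> = 1" by (rule abs_zmult_eq_1)
    then have "\<bar>real_of_int D\<bar> = 1" by linarith
    then show False using e2 C assms(2) by simp
  qed
  have root: "l ^ 2 = of_int t * l - of_int d"
  proof -
    have "(l - of_int A) * (l - of_int D) = (l - of_int A) * (of_int C * x)"
      using e2 by simp
    also have "\<dots> = of_int C * (l * x - of_int A * x)" by (simp add: algebra_simps)
    also have "\<dots> = of_int E * of_int C" unfolding e1[symmetric] by simp
    finally show ?thesis by (simp add: t_def d_def power2_eq_square algebra_simps)
  qed
  \<comment> \<open>The other eigenvalue, of modulus \<open>1 / l < 1\<close>.\<close>
  define m where "m = of_int d / l"
  have lm: "l + m = of_int t" "l * m = of_int d"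
    using root assms(2) by (auto simp: m_def field_simps power2_eq_square)
  have "\<bar>real_of_int d\<bar> = 1" using d by linarith
  then have m1: "\<bar>m\<bar> < 1" using assms(2) by (simp add: m_def)
  \<comment> \<open>Independent of \<open>N\<close>. By Binet, \<kappa> times the absolute value of
    \<open>u * C\<close> is half that of \<open>l ^ Suc j - m ^ Suc j\<close>; the 2 absorbs the
    power of \<open>m\<close>.\<close>
  define \<kappa> where "\<kappa> = (l - m) / (2 * \<bar>of_int C\<bar>)"
  have "\<kappa> > 0" using m1 assms(2) \<open>C \<noteq> 0\<close> by (simp add: \<kappa>_def)
  moreover have "\<exists>A E C D l. unit_eigen x A E C D l \<and> C \<noteq> 0 \<and> N dvd C \<and>
    \<kappa> * \<bar>of_int C\<bar> \<le> l" if N: "N > 0" for N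
  proof -
    obtain j where j: "N dvd lucas t d (Suc j)" using lucas_divisible[OF d N] .
    define u v where "u = lucas t d (Suc j)" and "v = lucas t d j"
    have binet: "(l - m) * of_int u = l ^ Suc j - m ^ Suc j"
      unfolding u_def by (rule lucas_binet[OF lm])
    have mj: "\<bar>m ^ Suc j\<bar> < 1" 
      using m1 power_strict_mono[of "\<bar>m\<bar>" 1 "Suc j"] by (simp add: power_abs del: power_Suc)
    have lj: "1 < l ^ Suc j" using assms(2) by (rule one_less_power) simp
    have up: "(l - m) * of_int u > 0" unfolding binet using mj lj by linarith
    have "u \<noteq> 0" using up by auto
    have abs: "\<bar>(l - m) * of_int u\<bar> \<le> 2 * l ^ Suc j" unfolding binet using mj lj by linarith
    have pow: "of_int u * l - of_int d * of_int v = l ^ Suc j"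
      unfolding u_def v_def by (rule lucas_root_power[OF root])
    \<comment> \<open>These are the entries of \<open>u Q - d v I\<close>, the power of exponent
      \<open>Suc j\<close> of the original matrix \<open>Q\<close>.\<close>
    have "unit_eigen x (u * A - d * v) (u * E) (u * C) (u * D - d * v) (l ^ Suc j)"
    proof -
      have "(u * A - d * v) * (u * D - d * v) - (u * E) * (u * C)
          = u ^ 2 * (A * D - E * C) - d * (A + D) * u * v + d ^ 2 * v ^ 2"
        by (simp add: power2_eq_square algebra_simps)
      also have "\<dots> = d * (u ^ 2 - t * u * v + d * v ^ 2)"
        unfolding t_def[symmetric] d_def[symmetric] by (simp add: power2_eq_square algebra_simps)
      also have "\<dots> = d ^ Suc j" using lucas_norm[of t d j] by (simp add: u_def v_def)
      finally have 1: "\<bar>(u * A - d * v) * (u * D - d * v) - (u * E) * (u * C)\<bar> = 1"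
        by (simp add: power_abs d abs_mult)
      have "of_int (u * A - d * v) * x + of_int (u * E) =
          of_int u * (of_int A * x + of_int E) - of_int d * of_int v * x"
        by (simp add: algebra_simps)
      also have "\<dots> = l ^ Suc j * x" unfolding e1 pow[symmetric] by (simp add: algebra_simps)
      finally have 2: "of_int (u * A - d * v) * x + of_int (u * E) = l ^ Suc j * x" .
      have "of_int (u * C) * x + of_int (u * D - d * v) =
          of_int u * (of_int C * x + of_int D) - of_int d * of_int v"
        by (simp add: algebra_simps)
      also have "\<dots> = l ^ Suc j" unfolding e2 by (rule pow)
      finally show ?thesis using 1 2 unfolding unit_eigen_def by blast
    qed
    moreover have "u * C \<noteq> 0" using \<open>u \<noteq> 0\<close> \<open>C \<noteq> 0\<close> by simp
    moreover have "N dvd u * C" using j by (simp add: u_def)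
    moreover have "\<kappa> * \<bar>of_int (u * C)\<bar> \<le> l ^ Suc j"
    proof -
      have "\<kappa> * \<bar>of_int (u * C)\<bar> = (l - m) * \<bar>of_int u\<bar> / 2"
        using \<open>C \<noteq> 0\<close> by (simp add: \<kappa>_def abs_mult)
      also have "\<dots> = \<bar>(l - m) * of_int u\<bar> / 2"
        using m1 assms(2) by (simp add: abs_mult)
      finally have "\<kappa> * \<bar>of_int (u * C)\<bar> = \<bar>(l - m) * of_int u\<bar> / 2" .
      then show ?thesis using abs by linarith
    qed
    ultimately show ?thesis by blast
  qed
  ultimately show thesis by (rule that)
qed

section \<open>Recognising complete quotients and bounding \<open>B\<close> from below\<close>

text \<open>Hardy and Wright, Theorem 172, in terms of complete quotients.\<close>

lemma complete_quotient_of_mobius: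
  fixes x y :: real and A E c D :: int
  assumes "0 < D" "D < c" "\<bar>A * D - E * c\<bar> = 1" "1 < y"
    "x * (of_int c * y + of_int D) = of_int A * y + of_int E"
  shows "\<exists>k\<ge>1. complete_quotient x k = y"
  using assms
proof (induction "nat c" arbitrary: x A E c D rule: less_induct)
  case less
  note h = less.prems
  \<comment> \<open>\<open>a\<close> will be the integer part of \<open>x\<close>. Determinant 1 or
    -1 then confines \<open>E'\<close> to the range from 0 to \<open>A'\<close> and below
    \<open>D\<close>, so that \<open>x - a\<close> lies strictly between 0 and 1.\<close>
  define a A' E' where "a = A div c" and "A' = A mod c" and "E' = E - a * D"
  have A: "A = a * c + A'" by (simp add: a_def A'_def)
  have E: "E = a * D + E'" by (simp add: E'_def)
  have det: "\<bar>A' * D - E' * c\<bar> = 1" using h(3) unfolding A E by (simp add: algebra_simps)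
  have c2: "c \<ge> 2" using h by linarith
  have "A' \<noteq> 0"
  proof
    assume "A' = 0"
    then have "\<bar>c * E'\<bar> = 1" using det by (simp add: mult.commute)
    then have "\<bar>c\<bar> = 1" by (rule abs_zmult_eq_1)
    then show False using c2 by simp
  qed
  then have A': "0 < A'" "A' < c" 
    using c2 pos_mod_bound[of c A] pos_mod_sign[of c A] unfolding A'_def by linarith+
  have E0: "0 \<le> E'"
  proof (rule ccontr)
    assume "\<not> 0 \<le> E'"
    then have "E' * c \<le> - 1 * c" using c2 by (intro mult_right_mono) auto
    moreover have "0 < A' * D" using A' h by simp
    ultimately show False using det c2 by linarith
  qed
  have EA: "E' \<le> A'"
  proof (rule ccontr)
    assume "\<not> E' \<le> A'"
    then have "(A' + 1) * c \<le> E' * c" using c2 by (intro mult_right_mono) auto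
    moreover have "A' * D \<le> A' * c" using A' h by simp
    ultimately show False using det c2 by (simp add: algebra_simps)
  qed
  have ED: "E' \<le> D"
  proof (rule ccontr)
    assume "\<not> E' \<le> D"
    then have "(D + 1) * c \<le> E' * c" using c2 by (intro mult_right_mono) auto
    moreover have "A' * D \<le> c * D" using A' h by simp
    ultimately show False using det c2 by (simp add: algebra_simps)
  qed
  let ?p = "of_int A' * y + of_int E'" and ?q = "of_int c * y + of_int D"
  have x: "(x - of_int a) * ?q = ?p" using h(5) unfolding A E by (simp add: algebra_simps)
  have pp: "0 < ?p" using A' E0 h(4) by (intro add_pos_nonneg mult_pos_pos) auto
  have pq: "?p < ?q" using A' ED h(4) by (intro add_less_le_mono mult_strict_right_mono) auto
  define z where "z = ?q / ?p"
  have z: "complete_quotient x 1 = z"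
  proof (rule complete_quotient_1)
    show "(x - of_int a) * z = 1" using x pp pq by (simp add: z_def)
    show "1 < z" using pp pq by (simp add: z_def)
  qed
  have shift: "complete_quotient x (Suc k) = complete_quotient z k" for k
    using complete_quotient_shift[of x 1 k] z by simp
  \<comment> \<open>A Euclidean step for \<open>z = 1 / (x - a)\<close>. The boundary cases end it,
    with \<open>z = [c; y]\<close> and \<open>z = [c - 1; 1, y]\<close>; otherwise the denominators
    drop to \<open>A'\<close>, \<open>E'\<close>.\<close>
  consider "E' = 0" | "E' = A'" | "0 < E'" "E' < A'" using E0 EA by linarith
  then show ?case
  proof cases
    case 1
    then have "A' * D = 1" using det A' h by (simp add: abs_mult)
    then have "A' = 1" "D = 1" using A' h by (auto simp: pos_zmult_eq_1_iff)
    then have "(z - of_int c) * y = 1" using 1 h(4) by (simp add: z_def field_simps)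
    then have "complete_quotient z 1 = y" using complete_quotient_1 h(4) by blast
    then show ?thesis using shift[of 1] by (metis le_add1 plus_1_eq_Suc)
  next
    case 2
    have "A' * (c - D) = 1" using det A' h unfolding 2
      by (simp add: right_diff_distrib[symmetric] abs_mult)
    then have *: "A' = 1" "D = c - 1" using A' h by (auto simp: pos_zmult_eq_1_iff)
    then have "real_of_int D = of_int c - 1" by simp
    then have "z * (y + 1) = of_int c * y + of_int c - 1"
      using * 2 h(4) by (simp add: z_def)
    then have z: "(z - of_int (c - 1)) * (y + 1) = y" by (simp add: algebra_simps)
    have "complete_quotient z 1 = (y + 1) / y"
    proof (rule complete_quotient_1)
      show "(z - of_int (c - 1)) * ((y + 1) / y) = 1"
        using h(4) z by (simp add: field_simps)
    qed (use h(4) in auto)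
    moreover have "complete_quotient ((y + 1) / y) 1 = y"
    proof (rule complete_quotient_1)
      show "((y + 1) / y - of_int 1) * y = 1" using h(4) by (simp add: field_simps)
    qed (use h(4) in auto)
    ultimately have "complete_quotient z (1 + 1) = y" by (simp only: complete_quotient_shift)
    then show ?thesis using shift[of "1 + 1"] by (metis le_add1 plus_1_eq_Suc)
  next
    case 3
    have "\<exists>k\<ge>1. complete_quotient z k = y"
    proof (rule less.hyps)
      show "nat A' < nat c" using A' by simp
      show "\<bar>c * E' - D * A'\<bar> = 1" using det by (simp add: algebra_simps abs_minus_commute)
      show "z * ?p = of_int c * y + of_int D" using pp by (simp add: z_def)
    qed (use 3 h in auto)
    then show ?thesis using shift by (metis le_Suc_eq)
  qed
qed

text \<open>Translating \<open>w\<close> by \<open>t = D div c\<close> reduces \<open>D\<close>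
  modulo \<open>c\<close> and makes \<open>y = w + t\<close> a complete quotient of
  \<open>x\<close>. The remainder is nonzero since \<open>D\<close> is prime to \<open>c\<close> and
  \<open>c\<close> is at least 2. Subtracting \<open>D' / c < 1\<close> from the bound
  \<open>M + 2\<close> leaves \<open>y > M + 1\<close>. Keeping \<open>w\<close> apart from
  \<open>x\<close> leaves room for a sign.\<close>

lemma B_ge_of_mobius:
  fixes x w :: real and A E c D :: int
  assumes "2 \<le> c" "\<bar>A * D - E * c\<bar> = 1"
    "x * (of_int c * w + of_int D) = of_int A * w + of_int E"
    "real M + 2 \<le> (of_int c * w + of_int D) / of_int c"
  shows "enat M \<le> B x"
proof (cases "M = 0")
  case False
  define t D' where "t = D div c" and "D' = D mod c"
  have D: "D = t * c + D'" by (simp add: t_def D'_def)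
  define y where "y = w + of_int t"
  have "D' \<noteq> 0"
  proof
    assume "D' = 0"
    then have "c dvd D" by (simp add: D'_def dvd_eq_mod_eq_0)
    then have "c dvd A * D - E * c" by simp
    then have "c dvd \<bar>A * D - E * c\<bar>" by simp
    then show False using assms by simp
  qed
  then have D': "0 < D'" "D' < c" 
    using assms(1) pos_mod_bound[of c D] pos_mod_sign[of c D] unfolding D'_def by linarith+
  have q: "of_int c * y + of_int D' = of_int c * w + real_of_int D"
    unfolding D y_def by (simp add: algebra_simps)
  have "y = (of_int c * w + of_int D) / of_int c - of_int D' / of_int c"
    unfolding q[symmetric] using assms(1) by (simp add: field_simps)
  moreover have "real_of_int D' / of_int c < 1" using D' by simp
  ultimately have y: "real M + 1 < y" using assms(4) by linarith
  have "\<exists>k\<ge>1. complete_quotient x k = y"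
  proof (rule complete_quotient_of_mobius)
    show "\<bar>A * D' - (E - A * t) * c\<bar> = 1" using assms(2) unfolding D by (simp add: algebra_simps)
    show "x * (of_int c * y + of_int D') = of_int A * y + of_int (E - A * t)"
      unfolding q assms(3) by (simp add: y_def algebra_simps)
    show "1 < y" using y by linarith
  qed (use D' in auto)
  then obtain k where k: "k \<ge> 1" "complete_quotient x k = y" by blast
  have "int M \<le> cf_expansion x k" using y k by (simp add: cf_expansion_def le_floor_iff)
  then have "enat M \<le> enat (nat (cf_expansion x k))" by simp
  also have "\<dots> \<le> B x" unfolding B_def using k by (intro SUP_upper) auto
  finally show ?thesis .
qed (simp add: enat_0)

section \<open>Growth of \<open>B\<close> along multiplication by powers of \<open>n\<close>\<close>

lemma EVP_B_ge:
  assumes "cf_expansion x \<in> EVP" "2 \<le> n"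
  obtains k where "k \<ge> 1" "\<And>i. i \<ge> 1 \<Longrightarrow> enat (n ^ i) \<le> B (real n ^ (i + k) * x)"
proof -
  obtain A E C D l where "unit_eigen x A E C D l" "1 < l"
    using EVP_unit_eigen[OF assms(1)] .
  then obtain \<kappa> where \<kappa>: "\<kappa> > 0" and ex: "\<And>N. N > 0 \<Longrightarrow> \<exists>A E C D l. unit_eigen x A E C D l \<and>
    C \<noteq> 0 \<and> N dvd C \<and> \<kappa> * \<bar>of_int C\<bar> \<le> l"
    using unit_eigen_divisible by metis
  \<comment> \<open>The 3 comes from \<open>n ^ i + 2 \<le> 3 * n ^ i\<close>, matching the slack in
    \<open>B_ge_of_mobius\<close>.\<close>
  obtain k where k: "3 / \<kappa> < real n ^ k" using real_arch_pow[of "real n"] assms(2) by auto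
  have "enat (n ^ i) \<le> B (real n ^ (i + Suc k) * x)" for i
  proof -
    define m where "m = i + Suc k"
    \<comment> \<open>The spare factor \<open>n\<close> keeps the lower left entry away from \<open>1\<close>, as \<open>B_ge_of_mobius\<close> needs.\<close>
    obtain A E C D l where u: "unit_eigen x A E C D l" and C: "C \<noteq> 0"
      and dv: "int n ^ Suc m dvd C" and le: "\<kappa> * \<bar>of_int C\<bar> \<le> l"
      using ex[of "int n ^ Suc m"] assms(2) by auto
    from dv obtain C1 where C1: "C = int n ^ Suc m * C1" by auto
    define c where "c = int n * \<bar>C1\<bar>"
    \<comment> \<open>\<open>C\<close> may be negative; the sign is absorbed by applying \<open>B_ge_of_mobius\<close> to
      \<open>sgn C1 * n ^ m * x\<close>.\<close>
    have Cs: "C = sgn C1 * (int n ^ m * c)"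
      using sgn_mult_abs[of C1] by (simp add: C1 c_def mult.left_commute)
    have C10: "C1 \<noteq> 0" using C C1 by auto
    have ss: "sgn C1 * sgn C1 = 1" using C10 by (simp add: sgn_if)
    have sr: "real_of_int (sgn C1) * of_int (sgn C1) = 1" using ss by (metis of_int_1 of_int_mult)
    have "int n * 1 \<le> c" unfolding c_def using C10 by (intro mult_left_mono) auto
    then have c2: "2 \<le> c" using assms(2) by linarith
    have u1: "\<bar>A * D - E * C\<bar> = 1" and u2: "of_int A * x + of_int E = l * x"
      and u3: "of_int C * x + of_int D = l" using u by (auto simp: unit_eigen_def)
    let ?b = "real n ^ m * x" and ?s = "real_of_int (sgn C1)"
    have den: "of_int c * (?s * ?b) + of_int D = l"
      unfolding u3[symmetric] Cs by (simp add: algebra_simps)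
    have "enat (n ^ i) \<le> B ?b"
    proof (rule B_ge_of_mobius)
      show "2 \<le> c" by (rule c2)
      have "sgn C1 * (sgn C1 * A * D - int n ^ m * E * c) = (sgn C1 * sgn C1) * A * D - E * C"
        unfolding Cs by (simp add: algebra_simps)
      then have "\<bar>sgn C1 * (sgn C1 * A * D - int n ^ m * E * c)\<bar> = 1" using u1 ss by simp
      then show "\<bar>sgn C1 * A * D - int n ^ m * E * c\<bar> = 1" using C10 by (simp add: abs_mult)
      have "of_int (sgn C1 * A) * (?s * ?b) + of_int (int n ^ m * E) =
          real n ^ m * ((?s * ?s) * of_int A * x + of_int E)"
        by (simp add: algebra_simps)
      also have "\<dots> = ?b * l" using u2 sr by simp
      finally show "?b * (of_int c * (?s * ?b) + of_int D) =
        of_int (sgn C1 * A) * (?s * ?b) + of_int (int n ^ m * E)" unfolding den by simp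
      have "\<bar>real_of_int C\<bar> = real n ^ m * of_int c"
        using c2 C10 unfolding Cs by (simp add: abs_mult sgn_if)
      then have "\<kappa> * real n ^ m \<le> l / of_int c" using le c2 by (simp add: field_simps)
      moreover have "3 * real n ^ i \<le> \<kappa> * real n ^ m"
      proof -
        have "3 \<le> \<kappa> * real n ^ k" using k \<kappa> by (simp add: field_simps)
        also have "\<dots> \<le> \<kappa> * real n ^ Suc k"
          using \<kappa> assms(2) by (intro mult_left_mono power_increasing) auto
        finally have "3 * real n ^ i \<le> (\<kappa> * real n ^ Suc k) * real n ^ i"
          by (intro mult_right_mono) auto
        then show ?thesis by (simp add: m_def power_add ac_simps)
      qed
      moreover have "1 \<le> real n ^ i" using assms(2) by (intro one_le_power) auto
      ultimately show "real (n ^ i) + 2 \<le> (of_int c * (?s * ?b) + of_int D) / of_int c"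
        unfolding den by simp
    qed
    then show ?thesis by (simp add: m_def)
  qed
  then show thesis by (intro that[of "Suc k"]) auto
qed

lemma tendsto_enat_PInf:
  fixes f :: "nat \<Rightarrow> enat"
  assumes "\<And>M. \<forall>\<^sub>F i in sequentially. enat M \<le> f i"
  shows "f \<longlonglongrightarrow> \<infinity>"
proof (rule order_tendstoI)
  fix a :: enat assume "a < \<infinity>"
  then obtain M where M: "a = enat M" by (cases a) auto
  show "\<forall>\<^sub>F i in sequentially. a < f i"
    using assms[of "Suc M"] by eventually_elim (auto simp: M intro: less_le_trans[rotated])
qed simp

section \<open>The p-adic Littlewood conjecture\<close>

lemma EVP_padic_littlewood:
  assumes "cf_expansion x \<in> EVP" "prime p"
  shows "padic_littlewood p x"
proof -
  let ?F = "\<lambda>q. real q * padic_norm p q * dist_nearest_int (real q * x)"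
  obtain A E C D l where "unit_eigen x A E C D l" "1 < l"
    using EVP_unit_eigen[OF assms(1)] .
  then obtain \<kappa> where \<kappa>: "\<kappa> > 0" and ex: "\<And>N. N > 0 \<Longrightarrow> \<exists>A E C D l. unit_eigen x A E C D l \<and>
    C \<noteq> 0 \<and> N dvd C \<and> \<kappa> * \<bar>of_int C\<bar> \<le> l"
    using unit_eigen_divisible by metis
  have p2: "2 \<le> p" using assms(2) by (rule prime_ge_2_nat)
  have bdd: "bdd_below (range (\<lambda>m::int. \<bar>y - of_int m\<bar>))" for y :: real
    by (rule bdd_belowI[of _ 0]) auto
  have dist0: "0 \<le> dist_nearest_int y" for y
    unfolding dist_nearest_int_def by (rule cINF_greatest) auto
  have F0: "0 \<le> ?F q" for q by (simp add: dist0 padic_norm_def)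
  \<comment> \<open>The bound \<open>q \<ge> p ^ m\<close> pushes the good denominators to infinity,
    as the liminf demands.\<close>
  have key: "\<exists>q\<ge>p ^ m. ?F q \<le> 1 / (\<kappa> * real p ^ m)" for m
  proof -
    obtain A E C D l where u: "unit_eigen x A E C D l" and C: "C \<noteq> 0"
      and dv: "int p ^ m dvd C" and le: "\<kappa> * \<bar>of_int C\<bar> \<le> l"
      using ex[of "int p ^ m"] p2 by auto
    have u1: "\<bar>A * D - E * C\<bar> = 1" and u2: "of_int A * x + of_int E = l * x"
      and u3: "of_int C * x + of_int D = l" using u by (auto simp: unit_eigen_def)
    define q where "q = nat \<bar>C\<bar>"
    have q: "q > 0" "real q = \<bar>of_int C\<bar>" using C by (auto simp: q_def)
    have "int (p ^ m) dvd int q" using dv by (simp add: q_def)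
    then have dq: "p ^ m dvd q" by (simp only: int_dvd_int_iff)
    have l0: "l > 0" using le \<kappa> C by (smt (verit) mult_pos_pos of_int_0_eq_iff zero_less_abs_iff)
    \<comment> \<open>By the trace, \<open>C * x - A\<close> is minus the second eigenvalue, so its
      product with \<open>l\<close> is minus the determinant.\<close>
    have "(of_int C * x - of_int A) * l = of_int C * (l * x) - of_int A * l" by (simp add: algebra_simps)
    also have "\<dots> = - of_int (A * D - E * C)"
      unfolding u2[symmetric] by (simp add: u3[symmetric] algebra_simps)
    finally have "\<bar>(of_int C * x - of_int A) * l\<bar> = real_of_int \<bar>A * D - E * C\<bar>"
      by (simp only: abs_minus_cancel of_int_abs)
    then have "\<bar>of_int C * x - of_int A\<bar> * l = 1" using l0 unfolding u1 by (simp add: abs_mult)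
    then have ap: "\<bar>of_int C * x - of_int A\<bar> = 1 / l"
      using l0 by (simp add: field_simps)
    \<comment> \<open>\<open>q\<close> is the absolute value of \<open>C\<close>, so the
      approximating integer \<open>A\<close> takes the sign of \<open>C\<close>.\<close>
    have "dist_nearest_int (real q * x) \<le> \<bar>real q * x - of_int (sgn C * A)\<bar>"
      unfolding dist_nearest_int_def by (rule cINF_lower[OF bdd]) simp
    also have "\<dots> = \<bar>of_int (sgn C) * (of_int C * x - of_int A)\<bar>"
      by (auto simp: q(2) algebra_simps sgn_if)
    also have "\<dots> = 1 / l" using C ap by (simp add: abs_mult sgn_if)
    finally have dl: "dist_nearest_int (real q * x) \<le> 1 / l" .
    have "m \<le> multiplicity p q" using q p2 dq by (intro multiplicity_geI) auto
    then have pn: "padic_norm p q \<le> 1 / real p ^ m"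
      using q p2 by (simp add: padic_norm_def frac_le power_increasing)
    have "?F q \<le> real q * (1 / real p ^ m) * (1 / l)"
      using pn dl dist0 by (intro mult_mono) (auto simp: padic_norm_def)
    also have "\<dots> = real q / l / real p ^ m" by simp
    also have "\<dots> \<le> (1 / \<kappa>) / real p ^ m"
      using le \<kappa> l0 unfolding q(2) by (intro divide_right_mono) (auto simp: field_simps)
    finally have "?F q \<le> 1 / (\<kappa> * real p ^ m)" by simp
    moreover have "p ^ m \<le> q" using dq q by (simp add: dvd_imp_le)
    ultimately show ?thesis by blast
  qed
  have small: "liminf (\<lambda>q. ereal (?F q)) \<le> ereal e" if e: "e > 0" for e
    unfolding liminf_SUP_INF
  proof (rule SUP_least)
    fix N :: nat
    obtain m where m: "max (real N) (1 / (\<kappa> * e)) < real p ^ m"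
      using real_arch_pow[of "real p" "max (real N) (1 / (\<kappa> * e))"] p2 by auto
    obtain q where q: "p ^ m \<le> q" "?F q \<le> 1 / (\<kappa> * real p ^ m)" using key by blast
    have "real N < real (p ^ m)" using m by simp
    then have "N \<le> q" using q by linarith
    have "1 / (\<kappa> * real p ^ m) \<le> e" using m \<kappa> e p2 by (simp add: field_simps)
    with q have "ereal (?F q) \<le> ereal e" unfolding ereal_less_eq by linarith
    then show "(INF q\<in>{N..}. ereal (?F q)) \<le> ereal e"
      by (rule INF_lower2[rotated]) (use \<open>N \<le> q\<close> in simp)
  qed
  have "liminf (\<lambda>q. ereal (?F q)) \<le> 0"
    by (rule ereal_le_epsilon2) (simp only: add_0_left small)
  moreover have "0 \<le> liminf (\<lambda>q. ereal (?F q))"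
    by (intro Liminf_bounded always_eventually allI) (simp only: ereal_less_eq F0)
  ultimately show ?thesis unfolding padic_littlewood_def by (rule antisym)
qed

theorem proposition3p10:
  shows "(\<forall>(n::nat) (\<alpha>::real). 2 \<le> n \<and> 0 < \<alpha> \<and> cf_expansion \<alpha> \<in> EVP_pos \<longrightarrow>
            ((\<lambda>i. B (real n ^ i * \<alpha>)) \<longlonglongrightarrow> \<infinity>) \<and>
            (\<exists>(a::nat) (k::nat). 1 \<le> a \<and> 1 \<le> k \<and>
               (\<forall>i\<ge>1. enat (n ^ i * a) \<le> B (real n ^ (i + k) * \<alpha>)))) \<and>
         (\<forall>(\<alpha>::real). cf_expansion \<alpha> \<in> EVP_pos \<longrightarrow>
            (\<forall>(p::nat). prime p \<longrightarrow> padic_littlewood p \<alpha>))"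
proof (intro conjI allI impI; (elim conjE)?)
  fix n :: nat and x :: real
  assume n: "2 \<le> n" and "cf_expansion x \<in> EVP_pos"
  then have "cf_expansion x \<in> EVP" by (simp add: EVP_pos_def)
  then obtain k where k: "k \<ge> 1" "\<And>i. i \<ge> 1 \<Longrightarrow> enat (n ^ i) \<le> B (real n ^ (i + k) * x)"
    using EVP_B_ge[OF _ n] by blast
  show "\<exists>a k. 1 \<le> a \<and> 1 \<le> k \<and> (\<forall>i\<ge>1. enat (n ^ i * a) \<le> B (real n ^ (i + k) * x))"
    using k by (intro exI[of _ 1] exI[of _ k]) auto
  show "(\<lambda>i. B (real n ^ i * x)) \<longlonglongrightarrow> \<infinity>"
  proof (rule tendsto_enat_PInf)
    fix M :: nat
    show "\<forall>\<^sub>F i in sequentially. enat M \<le> B (real n ^ i * x)"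
      \<comment> \<open>\<open>Suc\<close> ensures \<open>i - k \<ge> 1\<close>, which the bound
        \<open>k\<close> requires even when \<open>M = 0\<close>.\<close>
      using eventually_ge_at_top[of "Suc M + k"]
    proof eventually_elim
      case (elim i)
      have "M \<le> i - k" using elim by simp
      also have "i - k \<le> n ^ (i - k)" using n by (intro less_imp_le power_gt_expt) auto
      finally have "enat M \<le> enat (n ^ (i - k))" by simp
      also have "\<dots> \<le> B (real n ^ (i - k + k) * x)" using elim by (intro k) auto
      finally show ?case using elim by simp
    qed
  qed
next
  fix x :: real and p :: nat
  assume "cf_expansion x \<in> EVP_pos" "prime p"
  then show "padic_littlewood p x" by (intro EVP_padic_littlewood) (auto simp: EVP_pos_def)
qed

end
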